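(* Let $\mathcal{H}$ be an infinite dimensional separable complex Hilbert space. If $T\in B(\mathcal{H})$ is a Drazin invertible operator which is $(2,P)$-expansive for some positive operator $P\in B(\mathcal{H})$, then $T$ is $P$-isometric.
   Context: $B(\mathcal{H})$ is the algebra of bounded linear operators on $\mathcal{H}$. "Positive" means $P\geq 0$ (non-negative). $T\in B(\mathcal{H})$ is Drazin invertible, with Drazin inverse $T_d\in B(\mathcal{H})$, if $TT_d=T_dT$, $T_d^2T=T_d$ and $T^{p+1}T_d=T^p$ for some integer $p\geq 1$. $T$ is $(2,P)$-expansive if $P-2T^*PT+T^{*2}PT^2\leq 0$. $T$ is $P$-isometric if $\|P^{1/2}Tx\|^2=\|P^{1/2}x\|^2$ for every $x\in\mathcal{H}$, i.e. $T^*PT=P$. *)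

theory Defs
  imports "HOL-Analysis.Analysis"
begin

class complex_vector = real_vector +
  fixes scaleC :: "complex \<Rightarrow> 'a \<Rightarrow> 'a" (infixr \<open>*\<^sub>C\<close> 75)
  assumes scaleC_add_right: "a *\<^sub>C (x + y) = a *\<^sub>C x + a *\<^sub>C y"
    and scaleC_add_left: "(a + b) *\<^sub>C x = a *\<^sub>C x + b *\<^sub>C x"
    and scaleC_scaleC: "a *\<^sub>C (b *\<^sub>C x) = (a * b) *\<^sub>C x"
    and scaleC_one: "1 *\<^sub>C x = x"
    and scaleR_scaleC: "r *\<^sub>R x = complex_of_real r *\<^sub>C x"

global_interpretation complex_vector:
  vector_space "scaleC :: complex \<Rightarrow> 'a \<Rightarrow> 'a :: complex_vector"
  defines cspan = complex_vector.span
  by unfold_locales (simp_all add: scaleC_add_right scaleC_add_left scaleC_scaleC scaleC_one)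

(* The inner product is linear in its first argument. *)
class complex_inner = complex_vector + real_normed_vector +
  fixes cinner :: "'a \<Rightarrow> 'a \<Rightarrow> complex"
  assumes cinner_commute: "cinner x y = cnj (cinner y x)"
    and cinner_add_left: "cinner (x + y) z = cinner x z + cinner y z"
    and cinner_scaleC_left: "cinner (a *\<^sub>C x) y = a * cinner x y"
    and cinner_self_nonneg: "0 \<le> Re (cinner x x)"
    and cinner_self_eq_zero_iff: "cinner x x = 0 \<longleftrightarrow> x = 0"
    and norm_eq_sqrt_cinner: "norm x = sqrt (Re (cinner x x))"

class chilbert_space = complex_inner + complete_space

definition bounded_clinear :: "('a::complex_inner \<Rightarrow> 'a) \<Rightarrow> bool" where
  "bounded_clinear T \<longleftrightarrow>
     Vector_Spaces.linear scaleC scaleC T \<and> (\<exists>K. \<forall>x. norm (T x) \<le> K * norm x)"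

(* For bounded complex-linear T on a Hilbert space, such an S exists (Riesz representation)
   and is unique. *)
definition cadjoint :: "('a::chilbert_space \<Rightarrow> 'a) \<Rightarrow> 'a \<Rightarrow> 'a" where
  "cadjoint T = (SOME S. \<forall>x y. cinner (S x) y = cinner x (T y))"

definition positive_op :: "('a::complex_inner \<Rightarrow> 'a) \<Rightarrow> bool" where
  "positive_op A \<longleftrightarrow> bounded_clinear A \<and> (\<forall>x. cinner (A x) x \<in> \<real> \<and> 0 \<le> Re (cinner (A x) x))"

definition op_le :: "('a::complex_inner \<Rightarrow> 'a) \<Rightarrow> ('a \<Rightarrow> 'a) \<Rightarrow> bool" where
  "op_le A B \<longleftrightarrow> positive_op (\<lambda>x. B x - A x)"

(* For positive P on a Hilbert space, the positive square root exists and is unique. *)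
definition sqrt_op :: "('a::chilbert_space \<Rightarrow> 'a) \<Rightarrow> 'a \<Rightarrow> 'a" where
  "sqrt_op P = (SOME S. positive_op S \<and> S \<circ> S = P)"

definition is_drazin_inverse :: "('a::complex_inner \<Rightarrow> 'a) \<Rightarrow> ('a \<Rightarrow> 'a) \<Rightarrow> bool" where
  "is_drazin_inverse T S \<longleftrightarrow>
     bounded_clinear S \<and> T \<circ> S = S \<circ> T \<and> S \<circ> S \<circ> T = S \<and>
     (\<exists>p\<ge>1. (T ^^ (p + 1)) \<circ> S = T ^^ p)"

definition drazin_invertible :: "('a::complex_inner \<Rightarrow> 'a) \<Rightarrow> bool" where
  "drazin_invertible T \<longleftrightarrow> (\<exists>S. is_drazin_inverse T S)"

definition two_expansive :: "('a::chilbert_space \<Rightarrow> 'a) \<Rightarrow> ('a \<Rightarrow> 'a) \<Rightarrow> bool" where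
  "two_expansive P T \<longleftrightarrow>
     op_le (\<lambda>x. P x - 2 *\<^sub>C cadjoint T (P (T x)) + (cadjoint T ^^ 2) (P ((T ^^ 2) x))) (\<lambda>x. 0)"

definition P_isometric :: "('a::chilbert_space \<Rightarrow> 'a) \<Rightarrow> ('a \<Rightarrow> 'a) \<Rightarrow> bool" where
  "P_isometric P T \<longleftrightarrow> (\<forall>x. (norm (sqrt_op P (T x)))\<^sup>2 = (norm (sqrt_op P x))\<^sup>2)"

end

theory Submission
  imports Defs
begin

text \<open>
  Write \<open>q x = \<langle>P x, x\<rangle>\<close>. Being \<open>(2,P)\<close>-expansive says that \<open>q\<close> is concave along every orbit:
  \<open>q x - 2 q (T x) + q (T\<^sup>2 x) \<le> 0\<close>. As \<open>q\<close> is nonnegative, this has two consequences. A concave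
  sequence on the natural numbers that is bounded below cannot decrease, so \<open>q\<close> does not decrease
  under \<open>T\<close> (\<open>concave_orbit_mono\<close>). A concave sequence that also extends to the negative integers is
  constant, so \<open>q\<close> is constant on orbits that can be continued backwards
  (\<open>concave_backward_orbit_const\<close>).

  The Drazin inverse \<open>S\<close> splits \<open>x = u + y\<close> with \<open>y = T S x\<close>. On the range of \<open>T S\<close> the operator \<open>S\<close>
  inverts \<open>T\<close>, so \<open>y\<close> has a backward orbit and \<open>q (T y) = q y\<close>. On the other summand \<open>T\<close> is
  nilpotent: \<open>T\<^sup>p u = 0\<close>, hence \<open>q u \<le> q (T\<^sup>p u) = 0\<close>, and likewise \<open>q (T u) = 0\<close>. By the
  Cauchy-Schwarz inequality for \<open>P\<close>, a vector on which \<open>q\<close> vanishes can be added to any other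
  without changing the value of \<open>q\<close>. So \<open>q (T x) = q (T y) = q y = q x\<close>.

  To connect \<open>q\<close> with the operators in the statement, which are chosen by a description, the
  adjoint and the positive square root must be shown to exist. The adjoint comes from the Riesz
  representation theorem, proved by minimising \<open>\<parallel>x\<parallel>\<^sup>2 - 2 f x\<close>. The square root comes from the
  binomial series of \<open>sqrt (1 - t)\<close>, which converges absolutely on the closed unit disc and can
  therefore be evaluated at the positive contraction \<open>I - c P\<close> for a small \<open>c > 0\<close>.
\<close>

instance chilbert_space \<subseteq> banach ..

section \<open>Complex inner products\<close>

lemma cinner_add_right: "cinner x (y + z) = cinner x y + cinner x z"
  by (metis cinner_add_left cinner_commute complex_cnj_add)

lemma cinner_scaleC_right: "cinner x (a *\<^sub>C y) = cnj a * cinner x y"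
  by (metis cinner_commute cinner_scaleC_left complex_cnj_mult)

lemma cinner_scaleR_left: "cinner (r *\<^sub>R x) y = complex_of_real r * cinner x y"
  by (simp add: scaleR_scaleC cinner_scaleC_left)

lemma cinner_scaleR_right: "cinner x (r *\<^sub>R y) = complex_of_real r * cinner x y"
  by (simp add: scaleR_scaleC cinner_scaleC_right)

lemma cinner_zero_left: "cinner 0 x = 0"
  using cinner_scaleR_left[of 0 0 x] by simp

lemma cinner_diff_left: "cinner (x - y) z = cinner x z - cinner y z"
  by (metis add_diff_cancel_right' cinner_add_left diff_add_cancel)

lemma cinner_diff_right: "cinner x (y - z) = cinner x y - cinner x z"
  by (metis add_diff_cancel_right' cinner_add_right diff_add_cancel)

lemma Re_cinner_commute: "Re (cinner x y) = Re (cinner y x)"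
  by (metis cinner_commute complex_cnj(1) complex.sel(1) complex_surj)

lemma Im_cinner_self: "Im (cinner x x) = 0"
  using arg_cong[OF cinner_commute[of x x], of Im] by simp

lemma norm_sq_eq_Re_cinner: "(norm x)\<^sup>2 = Re (cinner x x)"
  by (simp add: norm_eq_sqrt_cinner cinner_self_nonneg)

lemma Re_cinner_i_right: "Re (cinner x (\<i> *\<^sub>C y)) = Im (cinner x y)"
  by (simp add: cinner_scaleC_right)

lemma norm_scaleC: "norm (a *\<^sub>C x) = cmod a * norm (x::'a::complex_inner)"
proof -
  have "(norm (a *\<^sub>C x))\<^sup>2 = Re ((a * cnj a) * cinner x x)"
    by (simp add: norm_sq_eq_Re_cinner cinner_scaleC_left cinner_scaleC_right mult_ac)
  also have "\<dots> = (cmod a * norm x)\<^sup>2"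
    by (simp add: complex_norm_square[symmetric] norm_sq_eq_Re_cinner power_mult_distrib)
  finally show ?thesis
    by (simp add: power2_eq_iff_nonneg)
qed

text \<open>
  This is stated for semidefinite forms because it is needed both for the inner product and for the
  form of a positive operator, which may vanish on nonzero vectors.
\<close>
lemma psd_form_Cauchy_Schwarz:
  fixes f :: "'a::real_vector \<Rightarrow> 'a \<Rightarrow> real"
  assumes add: "\<And>x y z. f (x + y) z = f x z + f y z"
    and scale: "\<And>r x y. f (r *\<^sub>R x) y = r * f x y"
    and sym: "\<And>x y. f x y = f y x"
    and nonneg: "\<And>x. 0 \<le> f x x"
  shows "(f x y)\<^sup>2 \<le> f x x * f y y"
proof -
  have add': "f z (u + v) = f z u + f z v" and scale': "f z (r *\<^sub>R u) = r * f z u" for z u v r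
    by (metis add sym, metis scale sym)
  have quad: "0 \<le> f x x + 2 * t * f x y + t\<^sup>2 * f y y" for t
    using nonneg[of "x + t *\<^sub>R y"]
    by (simp add: add scale add' scale' sym[of y x] algebra_simps power2_eq_square)
  show ?thesis
  proof (cases "f y y = 0")
    case True
    have "f x y = 0"
    proof (rule ccontr)
      assume "f x y \<noteq> 0"
      \<comment> \<open>With \<open>f y y = 0\<close> the quadratic is affine in \<open>t\<close>; at this \<open>t\<close> its value is \<open>-1\<close>.\<close>
      then show False
        using quad[of "- (f x x + 1) / (2 * f x y)"] True by (simp add: field_simps)
    qed
    then show ?thesis by (simp add: nonneg)
  next
    case False
    then have pos: "0 < f y y" using nonneg[of y] by simp
    \<comment> \<open>The value of the quadratic at its vertex.\<close>
    have "0 \<le> f x x - (f x y)\<^sup>2 / f y y"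
      using quad[of "- f x y / f y y"] False
      by (simp add: power2_eq_square field_simps)
    then show ?thesis using pos by (simp add: field_simps)
  qed
qed

lemma Re_cinner_le_norm: "\<bar>Re (cinner x y)\<bar> \<le> norm x * norm y"
proof -
  have "(Re (cinner x y))\<^sup>2 \<le> Re (cinner x x) * Re (cinner y y)"
    by (rule psd_form_Cauchy_Schwarz)
      (simp_all add: cinner_add_left cinner_scaleR_left Re_cinner_commute cinner_self_nonneg)
  then have "(Re (cinner x y))\<^sup>2 \<le> (norm x * norm y)\<^sup>2"
    by (simp add: power_mult_distrib norm_sq_eq_Re_cinner)
  then show ?thesis
    by (metis abs_le_square_iff abs_mult abs_norm_cancel)
qed

lemma bounded_linear_Re_cinner_left: "bounded_linear (\<lambda>x. Re (cinner x y))"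
  by (rule bounded_linear_intro[where K = "norm y"])
    (simp_all add: cinner_add_left cinner_scaleR_left Re_cinner_le_norm)

section \<open>Bounded operators\<close>

lemma bounded_clinear_iff:
  "bounded_clinear T \<longleftrightarrow> (\<forall>x y. T (x + y) = T x + T y) \<and> (\<forall>c x. T (c *\<^sub>C x) = c *\<^sub>C T x) \<and>
     (\<exists>K. \<forall>x. norm (T x) \<le> K * norm x)"
  unfolding bounded_clinear_def Vector_Spaces.linear_iff
  by (auto intro: complex_vector.vector_space_axioms)

lemma bounded_clinear_imp_bounded_linear:
  assumes "bounded_clinear T"
  shows "bounded_linear T"
proof -
  obtain K where "\<And>x. norm (T x) \<le> norm x * K"
    using assms unfolding bounded_clinear_iff by (auto simp: mult.commute)
  with assms show ?thesis
    by (intro bounded_linear_intro[where K = K]) (simp_all add: bounded_clinear_iff scaleR_scaleC)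
qed

lemma bounded_clinear_funpow:
  assumes "bounded_clinear T"
  shows "bounded_clinear (T ^^ n)"
proof (induction n)
  case 0
  show ?case unfolding bounded_clinear_iff by (auto intro: exI[of _ 1])
next
  case (Suc n)
  from bounded_linear_compose[OF bounded_clinear_imp_bounded_linear[OF assms]
      bounded_clinear_imp_bounded_linear[OF Suc]]
  have "\<exists>K. \<forall>x. norm (T ((T ^^ n) x)) \<le> norm x * K"
    by (rule bounded_linear.bounded)
  then show ?case
    using assms Suc unfolding bounded_clinear_iff by (auto simp: mult.commute)
qed

text \<open>
  On a complex space a real quadratic form forces symmetry: polarisation with \<open>u + \<i> v\<close> turns the
  vanishing of the imaginary part into the symmetry of the real part, and replacing \<open>v\<close> by
  \<open>\<i> v\<close> then gives the antisymmetry of the imaginary part.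
\<close>
lemma positive_op_symmetric:
  assumes "positive_op A"
  shows "cinner (A x) y = cinner x (A y)"
proof -
  have add: "\<And>u v. A (u + v) = A u + A v" and scale: "\<And>c u. A (c *\<^sub>C u) = c *\<^sub>C A u"
    and real: "\<And>u. Im (cinner (A u) u) = 0"
    using assms unfolding positive_op_def bounded_clinear_iff
    by (auto simp: complex_is_Real_iff)
  have Re_swap: "Re (cinner (A u) v) = Re (cinner (A v) u)" for u v
    using real[of "u + \<i> *\<^sub>C v"] real[of u] real[of v]
    by (simp add: add scale cinner_add_left cinner_add_right cinner_scaleC_left
        cinner_scaleC_right)
  have "Im (cinner (A x) y) = - Im (cinner (A y) x)"
    using Re_swap[of x "\<i> *\<^sub>C y"] by (simp add: scale cinner_scaleC_left cinner_scaleC_right)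
  with Re_swap[of x y] have "cinner (A x) y = cnj (cinner (A y) x)"
    by (simp add: complex_eq_iff)
  then show ?thesis by (metis cinner_commute)
qed

lemma positive_op_Cauchy_Schwarz:
  assumes "positive_op A"
  shows "(Re (cinner (A x) y))\<^sup>2 \<le> Re (cinner (A x) x) * Re (cinner (A y) y)"
proof (rule psd_form_Cauchy_Schwarz[where f = "\<lambda>x y. Re (cinner (A x) y)"])
  interpret A: bounded_linear A
    using assms by (simp add: positive_op_def bounded_clinear_imp_bounded_linear)
  show "Re (cinner (A (x + y)) z) = Re (cinner (A x) z) + Re (cinner (A y) z)" for x y z
    by (simp add: A.add cinner_add_left)
  show "Re (cinner (A (r *\<^sub>R x)) y) = r * Re (cinner (A x) y)" for r x y
    by (simp add: A.scaleR cinner_scaleR_left)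
  show "Re (cinner (A x) y) = Re (cinner (A y) x)" for x y
    by (metis positive_op_symmetric[OF assms] Re_cinner_commute)
  show "0 \<le> Re (cinner (A x) x)" for x
    using assms by (simp add: positive_op_def)
qed

section \<open>Existence of adjoints\<close>

text \<open>
  The representing vector is the minimiser of \<open>J x = \<parallel>x\<parallel>\<^sup>2 - 2 f x\<close>, because the derivative of \<open>J\<close>
  at \<open>z\<close> in direction \<open>y\<close> is \<open>2 (Re \<langle>y, z\<rangle> - f y)\<close>. By the parallelogram law two near-minimisers
  of \<open>J\<close> are close to each other, so a minimising sequence is Cauchy and completeness provides the
  minimiser. Real functionals suffice: the complex statement follows by scaling with \<open>\<i>\<close>.
\<close>
lemma Riesz_representation:
  fixes f :: "'a::chilbert_space \<Rightarrow> real"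
  assumes "bounded_linear f"
  shows "\<exists>z. \<forall>y. Re (cinner y z) = f y"
proof -
  interpret f: bounded_linear f by fact
  obtain K where K: "\<And>x. norm (f x) \<le> norm x * K" using f.bounded by blast
  define J where "J x = (norm x)\<^sup>2 - 2 * f x" for x
  \<comment> \<open>\<open>J x \<ge> \<parallel>x\<parallel>\<^sup>2 - 2 K \<parallel>x\<parallel>\<close>; complete the square.\<close>
  have lower: "- K\<^sup>2 \<le> J x" for x
  proof -
    have "0 \<le> (norm x - K)\<^sup>2" by simp
    then show ?thesis
      using K[of x] by (simp add: J_def power2_eq_square algebra_simps abs_le_iff)
  qed
  define m where "m = (INF x. J x)"
  have bdd: "bdd_below (range J)" using lower by (auto simp: bdd_below_def)
  have m_le: "m \<le> J x" for x
    unfolding m_def by (rule cINF_lower[OF bdd]) simp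
  have ex: "\<exists>x. J x < m + e" if "e > 0" for e
    using cINF_less_iff[OF _ bdd, of "m + e"] that by (auto simp: m_def)
  have parallelogram: "(norm (u - v))\<^sup>2 = 2 * (J u + J v - 2 * J ((1/2) *\<^sub>R (u + v)))" for u v
    by (simp add: J_def norm_sq_eq_Re_cinner f.scaleR f.add cinner_add_left cinner_add_right
        cinner_diff_left cinner_diff_right cinner_scaleR_left cinner_scaleR_right
        Re_cinner_commute[of v u] field_simps)
  have close: "(norm (u - v))\<^sup>2 \<le> 2 * (J u - m + (J v - m))" for u v
    using parallelogram[of u v] m_le[of "(1/2) *\<^sub>R (u + v)"] by simp
  obtain X where X: "\<And>n. J (X n) < m + inverse (real (Suc n))"
    using ex[of "inverse (real (Suc n))" for n] by (metis inverse_positive_iff_positive of_nat_0_less_iff zero_less_Suc)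
  have "Cauchy X"
  proof (rule metric_CauchyI)
    fix e :: real assume e: "0 < e"
    obtain N where N: "inverse (real (Suc N)) < e\<^sup>2 / 4"
      using reals_Archimedean[of "e\<^sup>2 / 4"] e by auto
    have small: "J (X n) - m < e\<^sup>2 / 4" if "n \<ge> N" for n
    proof -
      have "inverse (real (Suc n)) \<le> inverse (real (Suc N))"
        using that by (intro le_imp_inverse_le) auto
      then show ?thesis using X[of n] N by linarith
    qed
    have "dist (X k) (X n) < e" if "k \<ge> N" "n \<ge> N" for k n
    proof -
      have "(norm (X k - X n))\<^sup>2 < e\<^sup>2"
      proof (rule order_le_less_trans[OF close])
        show "2 * (J (X k) - m + (J (X n) - m)) < e\<^sup>2"
          using add_strict_mono[OF small[OF that(1)] small[OF that(2)]] by (simp add: field_simps)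
      qed
      then show ?thesis using e by (simp add: dist_norm power2_less_imp_less)
    qed
    then show "\<exists>N. \<forall>k\<ge>N. \<forall>n\<ge>N. dist (X k) (X n) < e" by blast
  qed
  then obtain z where z: "X \<longlonglongrightarrow> z" using Cauchy_convergent convergent_def by blast
  have "(\<lambda>n. J (X n)) \<longlonglongrightarrow> J z"
    unfolding J_def by (intro tendsto_intros f.tendsto z)
  moreover have "(\<lambda>n. m + inverse (real (Suc n))) \<longlonglongrightarrow> m + 0"
    by (intro tendsto_intros LIMSEQ_inverse_real_of_nat)
  ultimately have "J z \<le> m + 0"
    using X by (intro LIMSEQ_le[of "\<lambda>n. J (X n)" _ "\<lambda>n. m + inverse (real (Suc n))"])
      (auto intro: less_imp_le)
  with m_le have min: "J z \<le> J x" for x by (metis add_0_right order_trans)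
  have "Re (cinner y z) = f y" for y
  proof (rule ccontr)
    define d where "d = Re (cinner y z) - f y"
    assume "Re (cinner y z) \<noteq> f y"
    then have "d \<noteq> 0" by (simp add: d_def)
    then have y: "(norm y)\<^sup>2 > 0" by (auto simp: d_def f.zero cinner_zero_left)
    have expand: "J (z + t *\<^sub>R y) = J z + 2 * t * d + t\<^sup>2 * (norm y)\<^sup>2" for t
    proof -
      have "(norm (z + t *\<^sub>R y))\<^sup>2 = (norm z)\<^sup>2 + 2 * t * Re (cinner y z) + t * t * (norm y)\<^sup>2"
        by (simp add: norm_sq_eq_Re_cinner cinner_add_left cinner_add_right
            cinner_scaleR_left cinner_scaleR_right Re_cinner_commute[of z y] algebra_simps)
      then show ?thesis
        by (simp add: J_def d_def f.scaleR f.add power2_eq_square algebra_simps)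
    qed
    define s where "s = (norm y)\<^sup>2"
    have "0 \<le> 2 * t * d + t\<^sup>2 * s" for t
      using min[of "z + t *\<^sub>R y"] expand[of t] by (simp add: s_def)
    \<comment> \<open>The right-hand side is least at \<open>t = - d / s\<close>, where it equals \<open>- d\<^sup>2 / s\<close>.\<close>
    from this[of "- d / s"] have "d\<^sup>2 / s \<le> 0"
      using y[folded s_def] by (simp add: power2_eq_square field_simps)
    with y \<open>d \<noteq> 0\<close> show False by (simp add: s_def divide_le_0_iff)
  qed
  then show ?thesis by blast
qed

lemma cadjoint_cinner:
  assumes "bounded_clinear T"
  shows "cinner (cadjoint T x) y = cinner x (T y)"
proof -
  have ex: "\<exists>z. \<forall>y. cinner z y = cinner x (T y)" for x
  proof -
    have "bounded_linear (\<lambda>y. Re (cinner (T y) x))"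
      using bounded_linear_compose[OF bounded_linear_Re_cinner_left
          bounded_clinear_imp_bounded_linear[OF assms]] .
    then obtain z where z: "\<And>y. Re (cinner y z) = Re (cinner (T y) x)"
      using Riesz_representation by blast
    have "cinner y z = cinner (T y) x" for y
    proof -
      have "T (\<i> *\<^sub>C y) = \<i> *\<^sub>C T y" using assms by (simp add: bounded_clinear_iff)
      then have "Im (cinner y z) = Im (cinner (T y) x)"
        using z[of "\<i> *\<^sub>C y"] by (simp add: cinner_scaleC_left)
      with z[of y] show ?thesis by (simp add: complex_eq_iff)
    qed
    then show ?thesis by (metis cinner_commute)
  qed
  then have "\<exists>S. \<forall>x y. cinner (S x) y = cinner x (T y)" by metis
  then show ?thesis unfolding cadjoint_def by (rule someI2_ex) blast
qed

section \<open>Existence of positive square roots\<close>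

text \<open>
  The Taylor coefficients of \<open>sqrt (1 - t)\<close>. In this form the sign of the coefficients and a closed
  form for their partial sums can be read off from the recursions of the Pochhammer symbol.
\<close>
definition sqrt_coeff :: "nat \<Rightarrow> real" where
  "sqrt_coeff n = pochhammer (- 1 / 2) n / fact n"

lemma sqrt_coeff_0: "sqrt_coeff 0 = 1"
  by (simp add: sqrt_coeff_def)

lemma sqrt_coeff_nonpos: "n > 0 \<Longrightarrow> sqrt_coeff n \<le> 0"
proof -
  assume "n > 0"
  then obtain m where "n = Suc m" by (cases n) auto
  moreover have "0 \<le> pochhammer (1 / 2 :: real) m" by (rule pochhammer_nonneg) simp
  ultimately show ?thesis by (simp add: sqrt_coeff_def pochhammer_rec field_simps)
qed

text \<open>
  The partial sums are the coefficients of \<open>sqrt (1 - t) / (1 - t) = 1 / sqrt (1 - t)\<close>.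
\<close>
lemma sum_sqrt_coeff: "(\<Sum>k\<le>n. sqrt_coeff k) = pochhammer (1 / 2) n / fact n"
proof (induction n)
  case 0
  show ?case by (simp add: sqrt_coeff_def)
next
  case (Suc n)
  have "sqrt_coeff (Suc n) = - 1 / 2 * pochhammer (1 / 2) n / fact (Suc n)"
    by (simp add: sqrt_coeff_def pochhammer_rec)
  moreover have "pochhammer (1 / 2 :: real) n / fact n =
      real (Suc n) * pochhammer (1 / 2) n / fact (Suc n)"
    by (simp del: of_nat_Suc)
  ultimately have "(\<Sum>k\<le>Suc n. sqrt_coeff k) =
      (real (Suc n) * pochhammer (1 / 2) n + - 1 / 2 * pochhammer (1 / 2) n) / fact (Suc n)"
    by (simp only: sum.atMost_Suc Suc add_divide_distrib)
  then show ?case by (simp only: pochhammer_rec') (simp add: algebra_simps)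
qed

lemma sum_sqrt_coeff_nonneg: "0 \<le> (\<Sum>k\<le>n. sqrt_coeff k)"
  by (simp add: sum_sqrt_coeff pochhammer_nonneg)

text \<open>
  Only the coefficient at \<open>0\<close> is positive, so the sum of absolute values up to \<open>n\<close> is \<open>2\<close> minus the
  plain partial sum, and the partial sums are nonnegative.
\<close>
lemma abs_summable_sqrt_coeff: "summable (\<lambda>n. \<bar>sqrt_coeff n\<bar>)"
proof (rule bounded_imp_summable[where B = 2])
  have "(\<Sum>k\<le>n. \<bar>sqrt_coeff k\<bar>) = 2 - (\<Sum>k\<le>n. sqrt_coeff k)" for n
    by (induction n) (simp_all add: sqrt_coeff_0 sqrt_coeff_nonpos)
  then show "(\<Sum>k\<le>n. \<bar>sqrt_coeff k\<bar>) \<le> 2" for n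
    using sum_sqrt_coeff_nonneg[of n] by simp
qed simp

text \<open>
  The identity \<open>sqrt (1 - t) * sqrt (1 - t) = 1 - t\<close> on the level of coefficients, an instance of
  Vandermonde's identity for Pochhammer symbols.
\<close>
lemma sqrt_coeff_convolution:
  "(\<Sum>k\<le>n. sqrt_coeff k * sqrt_coeff (n - k)) = (if n = 0 then 1 else if n = 1 then - 1 else 0)"
proof -
  have "(\<Sum>k\<le>n. sqrt_coeff k * sqrt_coeff (n - k)) =
      (\<Sum>k\<le>n. of_nat (n choose k) * pochhammer (- 1 / 2) k * pochhammer (- 1 / 2) (n - k)) / fact n"
    unfolding sum_divide_distrib
    by (intro sum.cong refl) (simp add: sqrt_coeff_def binomial_fact field_simps)
  also have "\<dots> = pochhammer (- 1) n / fact n"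
    using pochhammer_binomial_sum[of "- 1 / 2 :: real" "- 1 / 2" n] by simp
  also have "\<dots> = (if n = 0 then 1 else if n = 1 then - 1 else 0)"
  proof (cases "n < 2")
    case True
    then show ?thesis by (auto simp: less_2_cases_iff)
  next
    case False
    then have "pochhammer (- 1 :: real) n = 0"
      using pochhammer_of_nat_eq_0_lemma[of 1 n, where 'a = real] by simp
    then show ?thesis using False by simp
  qed
  finally show ?thesis .
qed


lemma abs_summable_scaleR_bounded:
  fixes f :: "'i \<Rightarrow> 'a::banach"
  assumes "(\<lambda>i. \<bar>c i\<bar>) summable_on I" and "\<And>i. i \<in> I \<Longrightarrow> norm (f i) \<le> M"
  shows "(\<lambda>i. norm (c i *\<^sub>R f i)) summable_on I"
proof (rule Infinite_Sum.abs_summable_on_comparison_test')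
  show "(\<lambda>i. \<bar>c i\<bar> * M) summable_on I"
    by (rule summable_on_cmult_left[OF assms(1)])
  show "norm (c i *\<^sub>R f i) \<le> \<bar>c i\<bar> * M" if "i \<in> I" for i
    using assms(2)[OF that] by (simp add: mult_left_mono)
qed

lemma abs_summable_on_sqrt_coeff: "(\<lambda>n. \<bar>sqrt_coeff n\<bar>) summable_on UNIV"
  using abs_summable_sqrt_coeff by (intro norm_summable_imp_summable_on) simp

definition sqrt_one_minus :: "('a::chilbert_space \<Rightarrow> 'a) \<Rightarrow> 'a \<Rightarrow> 'a" where
  "sqrt_one_minus A x = (\<Sum>\<^sub>\<infinity>n. sqrt_coeff n *\<^sub>R (A ^^ n) x)"

locale positive_contraction =
  fixes A :: "'a::chilbert_space \<Rightarrow> 'a"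
  assumes positive: "positive_op A"
    and contraction: "\<And>x. norm (A x) \<le> norm x"
begin

lemma bounded_clinear_power: "bounded_clinear (A ^^ n)"
  using positive by (simp add: positive_op_def bounded_clinear_funpow)

lemma power_contraction: "norm ((A ^^ n) x) \<le> norm x"
  by (induction n) (auto intro: order_trans[OF contraction])

lemma power_symmetric: "cinner ((A ^^ n) x) y = cinner x ((A ^^ n) y)"
proof (induction n arbitrary: y)
  case (Suc n)
  have "cinner ((A ^^ Suc n) x) y = cinner x ((A ^^ n) (A y))"
    by (simp add: positive_op_symmetric[OF positive] Suc.IH)
  then show ?case by (simp add: funpow_swap1)
qed simp

lemma summable_series: "(\<lambda>n. sqrt_coeff n *\<^sub>R (A ^^ n) x) summable_on UNIV"
  by (rule abs_summable_summable, rule abs_summable_scaleR_bounded[OF abs_summable_on_sqrt_coeff])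
    (rule power_contraction)

lemma has_sum_image_sqrt_one_minus:
  assumes "bounded_linear h"
  shows "((\<lambda>n. sqrt_coeff n *\<^sub>R h ((A ^^ n) x)) has_sum h (sqrt_one_minus A x)) UNIV"
proof -
  interpret h: bounded_linear h by fact
  have "((\<lambda>n. h (sqrt_coeff n *\<^sub>R (A ^^ n) x)) has_sum h (sqrt_one_minus A x)) UNIV"
    unfolding sqrt_one_minus_def
    by (rule has_sum_bounded_linear[OF assms, unfolded o_def]) (rule has_sum_infsum[OF summable_series])
  then show ?thesis by (simp add: h.scaleR)
qed

lemma bounded_clinear_sqrt_one_minus: "bounded_clinear (sqrt_one_minus A)"
  unfolding bounded_clinear_iff
proof (intro conjI allI)
  show "sqrt_one_minus A (x + y) = sqrt_one_minus A x + sqrt_one_minus A y" for x y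
  proof -
    have "(A ^^ n) (x + y) = (A ^^ n) x + (A ^^ n) y" for n
      using bounded_clinear_power[of n] by (simp add: bounded_clinear_iff)
    then show ?thesis
      unfolding sqrt_one_minus_def
      by (simp add: scaleR_add_right infsum_add summable_series)
  qed
  show "sqrt_one_minus A (c *\<^sub>C x) = c *\<^sub>C sqrt_one_minus A x" for c x
  proof -
    have "bounded_linear (\<lambda>x::'a. c *\<^sub>C x)"
      by (rule bounded_linear_intro[where K = "cmod c"])
        (simp_all add: scaleC_add_right scaleR_scaleC scaleC_scaleC norm_scaleC mult.commute)
    from has_sum_image_sqrt_one_minus[OF this, of x]
    have "((\<lambda>n. sqrt_coeff n *\<^sub>R (A ^^ n) (c *\<^sub>C x)) has_sum c *\<^sub>C sqrt_one_minus A x) UNIV"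
      using bounded_clinear_power by (simp add: bounded_clinear_iff)
    then show ?thesis unfolding sqrt_one_minus_def by (rule infsumI)
  qed
  have "norm (sqrt_one_minus A x) \<le> (\<Sum>\<^sub>\<infinity>n. \<bar>sqrt_coeff n\<bar>) * norm x" for x
  proof -
    have "norm (sqrt_one_minus A x) \<le> (\<Sum>\<^sub>\<infinity>n. \<bar>sqrt_coeff n\<bar> * norm x)"
      unfolding sqrt_one_minus_def
      by (rule norm_infsum_le[OF has_sum_infsum[OF summable_series] has_sum_infsum])
        (simp_all add: summable_on_cmult_left abs_summable_on_sqrt_coeff mult_left_mono power_contraction)
    then show ?thesis by (simp add: infsum_cmult_left abs_summable_on_sqrt_coeff)
  qed
  then show "\<exists>K. \<forall>x. norm (sqrt_one_minus A x) \<le> K * norm x" by blast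
qed

text \<open>
  Term by term, \<open>sqrt_coeff n * \<langle>A\<^sup>n x, x\<rangle> \<ge> sqrt_coeff n * \<parallel>x\<parallel>\<^sup>2\<close>, since \<open>\<langle>A\<^sup>n x, x\<rangle> \<le> \<parallel>x\<parallel>\<^sup>2\<close> and the
  coefficients with \<open>n > 0\<close> are nonpositive, while for \<open>n = 0\<close> both sides agree. The partial sums
  of the coefficients are nonnegative, so the partial sums of the form are as well.
\<close>
lemma positive_op_sqrt_one_minus: "positive_op (sqrt_one_minus A)"
  unfolding positive_op_def
proof (intro conjI allI)
  show "bounded_clinear (sqrt_one_minus A)" by (rule bounded_clinear_sqrt_one_minus)
  fix x
  have "Im (cinner ((A ^^ n) x) x) = 0" for n
    by (metis power_symmetric cinner_commute complex_is_Real_iff Reals_cnj_iff)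
  then have "((\<lambda>n. 0) has_sum Im (cinner (sqrt_one_minus A x) x)) (UNIV :: nat set)"
    using has_sum_image_sqrt_one_minus[OF bounded_linear_Re_cinner_left[of "\<i> *\<^sub>C x"], of x]
    by (simp add: Re_cinner_i_right)
  from infsumI[OF this] have "Im (cinner (sqrt_one_minus A x) x) = 0"
    by simp
  then show "cinner (sqrt_one_minus A x) x \<in> \<real>"
    by (simp add: complex_is_Real_iff)
  define t where "t n = sqrt_coeff n * Re (cinner ((A ^^ n) x) x)" for n
  have t: "t sums Re (cinner (sqrt_one_minus A x) x)"
    using has_sum_image_sqrt_one_minus[OF bounded_linear_Re_cinner_left[of x], of x]
    unfolding t_def by (simp add: has_sum_imp_sums)
  have term_ge: "sqrt_coeff n * (norm x)\<^sup>2 \<le> t n" for n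
  proof (cases "n = 0")
    case True
    then show ?thesis by (simp add: t_def norm_sq_eq_Re_cinner)
  next
    case False
    have "Re (cinner ((A ^^ n) x) x) \<le> norm ((A ^^ n) x) * norm x"
      using Re_cinner_le_norm abs_le_D1 by blast
    also have "\<dots> \<le> (norm x)\<^sup>2"
      by (simp add: power2_eq_square mult_right_mono power_contraction)
    finally show ?thesis
      unfolding t_def using False by (intro mult_left_mono_neg) (simp_all add: sqrt_coeff_nonpos)
  qed
  have "0 \<le> (\<Sum>k\<le>n. t k)" for n
  proof -
    have "0 \<le> (\<Sum>k\<le>n. sqrt_coeff k) * (norm x)\<^sup>2"
      by (intro mult_nonneg_nonneg sum_sqrt_coeff_nonneg) simp
    also have "\<dots> \<le> (\<Sum>k\<le>n. t k)"
      unfolding sum_distrib_right by (rule sum_mono) (rule term_ge)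
    finally show ?thesis .
  qed
  with t show "0 \<le> Re (cinner (sqrt_one_minus A x) x)"
    unfolding sums_def_le by (intro LIMSEQ_le_const) auto
qed

text \<open>
  The two series are multiplied as a double series, which converges absolutely because \<open>A\<close> is a
  contraction; summing along the diagonals \<open>i + j = n\<close> leaves the convolution of the coefficients.
\<close>
lemma sqrt_one_minus_square: "sqrt_one_minus A (sqrt_one_minus A x) = x - A x"
proof -
  define F where "F i j = (sqrt_coeff i * sqrt_coeff j) *\<^sub>R (A ^^ (i + j)) x" for i j
  have "(\<lambda>(i, j). \<bar>sqrt_coeff i * sqrt_coeff j\<bar>) summable_on (UNIV \<times> UNIV)"
  proof -
    have "(\<lambda>z. norm ((\<lambda>(i, j). sqrt_coeff i * sqrt_coeff j) z)) summable_on (UNIV \<times> UNIV)"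
      unfolding Infinite_Sum.abs_summable_on_Sigma_iff
    proof (intro conjI ballI)
      show row: "(\<lambda>j. norm (case (i, j) of (i, j) \<Rightarrow> sqrt_coeff i * sqrt_coeff j)) summable_on UNIV" for i
        by (simp add: abs_mult summable_on_cmult_right abs_summable_on_sqrt_coeff)
      have "(\<Sum>\<^sub>\<infinity>j. norm (case (i, j) of (i, j) \<Rightarrow> sqrt_coeff i * sqrt_coeff j)) =
          \<bar>sqrt_coeff i\<bar> * (\<Sum>\<^sub>\<infinity>j. \<bar>sqrt_coeff j\<bar>)" for i
        by (simp add: abs_mult infsum_cmult_right abs_summable_on_sqrt_coeff)
      moreover have "0 \<le> (\<Sum>\<^sub>\<infinity>j. \<bar>sqrt_coeff j\<bar>)"
        by (rule infsum_nonneg) simp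
      ultimately show "(\<lambda>i. norm (\<Sum>\<^sub>\<infinity>j. norm (case (i, j) of (i, j) \<Rightarrow> sqrt_coeff i * sqrt_coeff j)))
          summable_on UNIV"
        by (simp only: real_norm_def abs_mult abs_abs)
          (intro summable_on_cmult_left abs_summable_on_sqrt_coeff)
    qed
    then show ?thesis by (simp add: case_prod_unfold)
  qed
  then have F_sum: "(\<lambda>(i, j). F i j) summable_on (UNIV \<times> UNIV)"
    unfolding F_def case_prod_unfold
    by (rule abs_summable_summable[OF abs_summable_scaleR_bounded]) (rule power_contraction)
  have inner: "(\<Sum>\<^sub>\<infinity>j. F i j) = sqrt_coeff i *\<^sub>R (A ^^ i) (sqrt_one_minus A x)" for i
  proof -
    have "bounded_linear (\<lambda>y. sqrt_coeff i *\<^sub>R (A ^^ i) y)"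
      by (intro bounded_linear_scaleR_right[THEN bounded_linear_compose]
          bounded_clinear_imp_bounded_linear bounded_clinear_power)
    from infsumI[OF has_sum_image_sqrt_one_minus[OF this, of x]]
    show ?thesis by (simp add: F_def funpow_add mult.commute)
  qed
  have "sqrt_one_minus A (sqrt_one_minus A x) = (\<Sum>\<^sub>\<infinity>i. \<Sum>\<^sub>\<infinity>j. F i j)"
    unfolding inner by (simp add: sqrt_one_minus_def)
  also have "\<dots> = (\<Sum>\<^sub>\<infinity>(i, j)\<in>UNIV \<times> UNIV. F i j)"
    using infsum_Sigma'_banach[OF F_sum] .
  also have "\<dots> = (\<Sum>\<^sub>\<infinity>(n, i)\<in>(SIGMA n:UNIV. {..n}). F i (n - i))"
    by (rule infsum_reindex_bij_witness[of _ "\<lambda>(n, i). (i, n - i)" "\<lambda>(i, j). (i + j, i)"]) auto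
  also have "\<dots> = (\<Sum>\<^sub>\<infinity>n. \<Sum>\<^sub>\<infinity>i\<in>{..n}. F i (n - i))"
  proof (rule infsum_Sigma'_banach[symmetric])
    show "(\<lambda>(n, i). F i (n - i)) summable_on (SIGMA n:UNIV. {..n})"
      using F_sum
      by (subst summable_on_reindex_bij_witness[of _ "\<lambda>(i, j). (i + j, i)" "\<lambda>(n, i). (i, n - i)"
            "UNIV \<times> UNIV" "\<lambda>(i, j). F i j"]) auto
  qed
  also have "\<dots> = (\<Sum>\<^sub>\<infinity>n. (\<Sum>i\<le>n. sqrt_coeff i * sqrt_coeff (n - i)) *\<^sub>R (A ^^ n) x)"
    by (intro infsum_cong) (simp add: F_def scaleR_sum_left)
  also have "\<dots> = (\<Sum>\<^sub>\<infinity>n\<in>{0, 1}. (if n = 0 then 1 else - 1) *\<^sub>R (A ^^ n) x)"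
    unfolding sqrt_coeff_convolution by (rule infsum_cong_neutral) auto
  also have "\<dots> = x - A x" by simp
  finally show ?thesis .
qed

end

text \<open>
  If \<open>c\<close> is the inverse of a bound for the norm of \<open>P\<close>, then \<open>A = I - c P\<close> satisfies
  \<open>0 \<le> \<langle>A x, x\<rangle> \<le> \<parallel>x\<parallel>\<^sup>2\<close>. The series needs the norm bound \<open>\<parallel>A x\<parallel> \<le> \<parallel>x\<parallel>\<close>, which the form bound
  gives through the Cauchy-Schwarz inequality for \<open>A\<close> at \<open>x\<close> and \<open>A x\<close>.
\<close>
lemma positive_sqrt_exists:
  fixes P :: "'a::chilbert_space \<Rightarrow> 'a"
  assumes P: "positive_op P"
  shows "\<exists>S. positive_op S \<and> S \<circ> S = P"
proof -
  interpret P: bounded_linear P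
    using P by (simp add: positive_op_def bounded_clinear_imp_bounded_linear)
  obtain K where K: "0 < K" "\<And>x. norm (P x) \<le> norm x * K"
    using P.pos_bounded by blast
  define c where "c = inverse K"
  then have c: "0 < c" "c * K = 1" using K(1) by simp_all
  define A where "A x = x - c *\<^sub>R P x" for x
  have form: "Re (cinner (A x) x) = (norm x)\<^sup>2 - c * Re (cinner (P x) x)" for x
    by (simp add: A_def cinner_diff_left cinner_scaleR_left norm_sq_eq_Re_cinner)
  have form_le: "Re (cinner (A x) x) \<le> (norm x)\<^sup>2" for x
    using P c(1) by (simp add: form positive_op_def)
  have form_nonneg: "0 \<le> Re (cinner (A x) x)" for x
  proof -
    have "Re (cinner (P x) x) \<le> norm (P x) * norm x"
      using Re_cinner_le_norm abs_le_D1 by blast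
    also have "\<dots> \<le> norm x * K * norm x"
      using K by (intro mult_right_mono) simp_all
    finally have "c * Re (cinner (P x) x) \<le> c * (norm x * K * norm x)"
      using c(1) by (intro mult_left_mono) simp_all
    also have "\<dots> = c * K * (norm x)\<^sup>2" by (simp add: power2_eq_square)
    finally show ?thesis by (simp add: form c(2))
  qed
  have "bounded_linear A"
    unfolding A_def by (intro bounded_linear_intros P.bounded_linear_axioms)
  then have "\<exists>C. \<forall>x. norm (A x) \<le> C * norm x"
    by (metis bounded_linear.bounded mult.commute)
  then have "bounded_clinear A"
    using P by (auto simp: bounded_clinear_iff positive_op_def A_def scaleR_scaleC
        scaleC_add_right scaleC_scaleC mult.commute complex_vector.scale_right_diff_distrib)
  then have A: "positive_op A"
    using P form_nonneg by (auto simp: positive_op_def complex_is_Real_iff A_def cinner_diff_left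
        cinner_scaleR_left Im_cinner_self)
  have "norm (A x) \<le> norm x" for x
  proof (cases "A x = 0")
    case False
    have "((norm (A x))\<^sup>2)\<^sup>2 \<le> Re (cinner (A x) x) * Re (cinner (A (A x)) (A x))"
      using positive_op_Cauchy_Schwarz[OF A, of x "A x"] by (simp add: norm_sq_eq_Re_cinner)
    also have "\<dots> \<le> (norm x)\<^sup>2 * (norm (A x))\<^sup>2"
      by (intro mult_mono form_le form_nonneg) simp
    finally have "(norm (A x))\<^sup>2 \<le> (norm x)\<^sup>2"
      using False by (simp add: power2_eq_square)
    then show ?thesis by (rule power2_le_imp_le) simp
  qed simp
  with A interpret positive_contraction A by unfold_locales
  define S where "S x = sqrt K *\<^sub>R sqrt_one_minus A x" for x
  interpret R: bounded_linear "sqrt_one_minus A"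
    by (rule bounded_clinear_imp_bounded_linear[OF bounded_clinear_sqrt_one_minus])
  have "sqrt K * (sqrt K * c) = (sqrt K * sqrt K) * c" by simp
  also have "\<dots> = 1" using K(1) c(2) by (simp add: mult.commute)
  finally have "sqrt K * (sqrt K * c) = 1" .
  then have "S (S x) = P x" for x
    by (simp add: S_def R.scaleR sqrt_one_minus_square A_def)
  then have "S \<circ> S = P" by auto
  moreover have "positive_op S"
  proof -
    have "bounded_linear S"
      unfolding S_def by (intro bounded_linear_intros R.bounded_linear_axioms)
    then have "\<exists>C. \<forall>x. norm (S x) \<le> C * norm x"
      by (metis bounded_linear.bounded mult.commute)
    then show ?thesis
      using positive_op_sqrt_one_minus K(1)
      by (auto simp: positive_op_def bounded_clinear_iff S_def scaleR_scaleC scaleC_add_right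
          scaleC_scaleC mult.commute cinner_scaleC_left complex_is_Real_iff)
  qed
  ultimately show ?thesis by blast
qed

lemma norm_sqrt_op:
  assumes "positive_op P"
  shows "(norm (sqrt_op P x))\<^sup>2 = Re (cinner (P x) x)"
proof -
  have "positive_op (sqrt_op P) \<and> sqrt_op P \<circ> sqrt_op P = P"
    unfolding sqrt_op_def by (rule someI_ex[OF positive_sqrt_exists[OF assms]])
  then have "cinner (sqrt_op P x) (sqrt_op P x) = cinner (P x) x"
    by (metis comp_apply positive_op_symmetric)
  then show ?thesis by (simp add: norm_sq_eq_Re_cinner)
qed

section \<open>Drazin invertible expansive operators\<close>

lemma two_expansive_form:
  assumes T: "bounded_clinear T" and "two_expansive P T"
  shows "Re (cinner (P x) x) - 2 * Re (cinner (P (T x)) (T x)) +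
    Re (cinner (P (T (T x))) (T (T x))) \<le> 0"
  using assms(2)[unfolded two_expansive_def op_le_def positive_op_def, THEN conjunct2, rule_format, of x]
  by (simp add: cinner_diff_left cinner_add_left cinner_scaleC_left cadjoint_cinner[OF T]
      numeral_2_eq_2 cinner_zero_left)

text \<open>
  The increments of \<open>q\<close> along the orbit do not increase. If the first one were negative, \<open>q\<close> would
  fall below a line of negative slope and become negative.
\<close>
lemma concave_orbit_mono:
  fixes q :: "'a \<Rightarrow> real"
  assumes nonneg: "\<And>x. 0 \<le> q x"
    and concave: "\<And>x. q x - 2 * q (T x) + q (T (T x)) \<le> 0"
  shows "q x \<le> q (T x)"
proof (rule ccontr)
  assume neg: "\<not> q x \<le> q (T x)"
  have step: "q ((T ^^ Suc n) x) - q ((T ^^ n) x) \<le> q (T x) - q x" for n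
  proof (induction n)
    case (Suc n)
    then show ?case using concave[of "(T ^^ n) x"] by simp
  qed simp
  have upper: "q ((T ^^ n) x) \<le> q x + real n * (q (T x) - q x)" for n
  proof (induction n)
    case (Suc n)
    then show ?case using step[of n] by (simp add: algebra_simps)
  qed simp
  obtain n where "q x < real n * (q x - q (T x))"
    using reals_Archimedean3[of "q x - q (T x)"] neg by auto
  then show False using upper[of n] nonneg[of "(T ^^ n) x"] by (simp add: algebra_simps)
qed

text \<open>
  Going backwards, the increments are at least \<open>D = q (T (y 0)) - q (y 0)\<close>. So \<open>q (y 0)\<close> exceeds
  \<open>q (y n) \<ge> 0\<close> by at least \<open>n D\<close> for every \<open>n\<close>, which excludes \<open>D > 0\<close>.
\<close>
lemma concave_backward_orbit_const:
  fixes q :: "'a \<Rightarrow> real"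
  assumes nonneg: "\<And>x. 0 \<le> q x"
    and concave: "\<And>x. q x - 2 * q (T x) + q (T (T x)) \<le> 0"
    and backward: "\<And>n. T (y (Suc n)) = y n"
  shows "q (T (y 0)) = q (y 0)"
proof -
  define D where "D = q (T (y 0)) - q (y 0)"
  have step: "D \<le> q (T (y n)) - q (y n)" for n
  proof (induction n)
    case (Suc n)
    then show ?case using concave[of "y (Suc n)"] by (simp add: backward)
  qed (simp add: D_def)
  have "real n * D + q (y n) \<le> q (y 0)" for n
  proof (induction n)
    case (Suc n)
    then show ?case using step[of "Suc n"] by (simp add: backward algebra_simps)
  qed simp
  with nonneg have "real n * D \<le> q (y 0)" for n
    by (smt (verit))
  then have "D \<le> 0"
    by (metis reals_Archimedean3 not_le)
  with concave_orbit_mono[of q T, OF nonneg concave, of "y 0"] show ?thesis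
    by (simp add: D_def)
qed

theorem proposition2p4:
  fixes T P :: "'a::chilbert_space \<Rightarrow> 'a"
  assumes infinite_dimensional: "\<nexists>B :: 'a set. finite B \<and> cspan B = UNIV"
    and separable: "separable_space (euclidean :: 'a topology)"
    and T_bounded: "bounded_clinear T"
    and T_drazin: "drazin_invertible T"
    and P_positive: "positive_op P"
    and expansive: "two_expansive P T"
  shows "P_isometric P T"
proof -
  define q where "q x = Re (cinner (P x) x)" for x
  have nonneg: "0 \<le> q x" for x using P_positive by (simp add: q_def positive_op_def)
  have concave: "q x - 2 * q (T x) + q (T (T x)) \<le> 0" for x
    unfolding q_def by (rule two_expansive_form[OF T_bounded expansive])
  have mono: "q x \<le> q (T x)" for x by (rule concave_orbit_mono[of q T, OF nonneg concave])
  have mono_power: "q x \<le> q ((T ^^ n) x)" for n x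
    by (induction n) (auto intro: order_trans[OF _ mono])
  interpret P: bounded_linear P
    using P_positive by (simp add: positive_op_def bounded_clinear_imp_bounded_linear)
  interpret T: bounded_linear T
    by (rule bounded_clinear_imp_bounded_linear[OF T_bounded])
  from T_drazin obtain S p where S: "T \<circ> S = S \<circ> T" "S \<circ> S \<circ> T = S"
    and p: "T ^^ (p + 1) \<circ> S = T ^^ p"
    unfolding drazin_invertible_def is_drazin_inverse_def by blast
  have TS: "T (S x) = S (T x)" and SST: "S (S (T x)) = S x" for x
    using S by (metis comp_apply)+
  have absorb: "q (u + y) = q y" if "q u = 0" for u y
  proof -
    have "Re (cinner (P u) y) = 0"
      using positive_op_Cauchy_Schwarz[OF P_positive, of u y] that by (simp add: q_def)
    moreover have "Re (cinner (P y) u) = Re (cinner (P u) y)"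
      by (metis positive_op_symmetric[OF P_positive] Re_cinner_commute)
    ultimately show ?thesis
      using that by (simp add: q_def P.add cinner_add_left cinner_add_right)
  qed
  have "q (T x) = q x" for x
  proof -
    define y where "y = T (S x)"
    define u where "u = x - y"
    \<comment> \<open>\<open>T\<^sup>p T S x = T\<^sup>p x\<close> is the last Drazin equation, and \<open>u = x - T S x\<close>.\<close>
    have Tpu: "(T ^^ p) u = 0"
    proof -
      interpret Tp: bounded_linear "T ^^ p"
        by (rule bounded_clinear_imp_bounded_linear[OF bounded_clinear_funpow[OF T_bounded]])
      have "(T ^^ p) x = (T ^^ p) (T (S x))"
        using fun_cong[OF p, of x] by (simp add: funpow_swap1)
      then show ?thesis by (simp add: u_def y_def Tp.diff)
    qed
    have qu: "q u = 0"
      using mono_power[of u p] nonneg[of u] by (simp add: Tpu q_def P.zero cinner_zero_left)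
    have qTu: "q (T u) = 0"
    proof -
      have "(T ^^ p) (T u) = 0" using Tpu by (metis funpow_swap1 T.zero)
      then show ?thesis
        using mono_power[of "T u" p] nonneg[of "T u"] by (simp add: q_def P.zero cinner_zero_left)
    qed
    \<comment> \<open>The backward orbit of \<open>y\<close> consists of the vectors \<open>S\<^sup>n y\<close>.\<close>
    have "T ((S ^^ Suc n) y) = (S ^^ n) y" for n
      by (induction n) (simp_all add: y_def TS SST)
    then have qy: "q (T y) = q y"
      using concave_backward_orbit_const[of q T "\<lambda>n. (S ^^ n) y", OF nonneg concave] by simp
    have "q (T x) = q (T u + T y)" by (simp add: u_def T.diff)
    also have "\<dots> = q (T y)" by (rule absorb[OF qTu])
    also have "\<dots> = q (u + y)" by (simp add: qy absorb[OF qu])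
    also have "\<dots> = q x" by (simp add: u_def)
    finally show ?thesis .
  qed
  then show ?thesis
    by (simp add: P_isometric_def norm_sqrt_op[OF P_positive] q_def)
qed

end
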